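(* Let $T_{12}$ be a set of patterns, each of which begins with the prefix $12$, and let $T_{21}$ be the set of patterns obtained by replacing, in each pattern in $T_{12}$, the prefix $12$ with the prefix $21$. For a shape $\mu$ and a set $T$ of patterns, let $\mu_{sym}(T)$ be the number of symmetric full placements on $\mu$ which avoid every pattern in $T$. Then for every self-conjugate shape $\mu$, $$\mu_{sym}(T_{12})=\mu_{sym}(T_{21}).$$
   Context: A shape is a Ferrers shape $\lambda=(\lambda_1\ge\lambda_2\ge\cdots\ge\lambda_k>0)$, coordinatized from the bottom left corner: box $(x,y)$ (column $x$ from the left, row $y$ from the bottom) belongs to $\lambda$ iff $1\le y\le k$ and $1\le x\le\lambda_y$. It is self-conjugate if $(x,y)\in\lambda$ iff $(y,x)\in\lambda$. A placement on $\lambda$ is an assignment of dots to some boxes of $\lambda$ such that no row or column contains more than one dot; it is full if each row and each column of $\lambda$ contains exactly one dot. A placement on a self-conjugate shape is symmetric if it has a dot in $(x,y)$ iff it has a dot in $(y,x)$. The pattern of a sequence of $m$ distinct numbers is its order-preserving relabelling by $1,\dots,m$. A pattern is a permutation $\sigma\in\mathcal{S}_m$ written in one-line notation. A placement on $\lambda$ contains $\sigma\in\mathcal{S}_m$ if there are $m$ dots $(x_1,y_1),\dots,(x_m,y_m)$ in the placement with $x_1<\cdots<x_m$, with the pattern of $y_1\ldots y_m$ equal to $\sigma$, and all lying in a rectangular subshape of $\lambda$ (i.e. the box $(\max_i x_i,\max_i y_i)$ lies in $\lambda$). Otherwise it avoids $\sigma$. A pattern begins with the prefix $12$ if it is of the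 form $12\tau_3\ldots\tau_k$ with $k\ge 2$ and $\tau=\tau_3\ldots\tau_k$ an ordering of $\{3,\dots,k\}$; replacing the prefix by $21$ gives $21\tau_3\ldots\tau_k$. *)

theory Defs
  imports Main
begin

text \<open>A Ferrers shape is the list of its row lengths, the list entry at index \<open>y - 1\<close> being the
  length of row \<open>y\<close>; rows are numbered from the bottom, so the longest row is row 1.\<close>

definition shape :: "nat list \<Rightarrow> bool" where
  "shape \<mu> \<longleftrightarrow> sorted_wrt (\<ge>) \<mu> \<and> (\<forall>l \<in> set \<mu>. l > 0)"

definition boxes :: "nat list \<Rightarrow> (nat \<times> nat) set" where
  "boxes \<mu> = {(x, y). 1 \<le> y \<and> y \<le> length \<mu> \<and> 1 \<le> x \<and> x \<le> \<mu> ! (y - 1)}"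

definition self_conjugate :: "nat list \<Rightarrow> bool" where
  "self_conjugate \<mu> \<longleftrightarrow> (\<forall>x y. (x, y) \<in> boxes \<mu> \<longleftrightarrow> (y, x) \<in> boxes \<mu>)"

text \<open>A placement is identified with its set of dots \<open>(column, row)\<close>.\<close>

definition placement :: "nat list \<Rightarrow> (nat \<times> nat) set \<Rightarrow> bool" where
  "placement \<mu> P \<longleftrightarrow> P \<subseteq> boxes \<mu> \<and> inj_on fst P \<and> inj_on snd P"

definition full_placement :: "nat list \<Rightarrow> (nat \<times> nat) set \<Rightarrow> bool" where
  "full_placement \<mu> P \<longleftrightarrow> placement \<mu> P
     \<and> (\<forall>x \<in> fst ` boxes \<mu>. \<exists>!d. d \<in> P \<and> fst d = x)
     \<and> (\<forall>y \<in> snd ` boxes \<mu>. \<exists>!d. d \<in> P \<and> snd d = y)"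

definition symmetric_dots :: "(nat \<times> nat) set \<Rightarrow> bool" where
  "symmetric_dots P \<longleftrightarrow> (\<forall>x y. (x, y) \<in> P \<longleftrightarrow> (y, x) \<in> P)"

definition is_pattern :: "nat list \<Rightarrow> bool" where
  "is_pattern \<sigma> \<longleftrightarrow> distinct \<sigma> \<and> set \<sigma> = {1..length \<sigma>}"

text \<open>Order-preserving relabelling: each entry is replaced by its rank among the entries.\<close>

definition pattern_of :: "nat list \<Rightarrow> nat list" where
  "pattern_of ys = map (\<lambda>y. card {z \<in> set ys. z \<le> y}) ys"

text \<open>The last conjunct is only meaningful for nonempty \<open>\<sigma>\<close>, since \<open>Max {}\<close> is unspecified.\<close>

definition contains_pattern :: "nat list \<Rightarrow> (nat \<times> nat) set \<Rightarrow> nat list \<Rightarrow> bool" where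
  "contains_pattern \<mu> P \<sigma> \<longleftrightarrow>
     (\<exists>ds. length ds = length \<sigma> \<and> set ds \<subseteq> P
         \<and> sorted_wrt (<) (map fst ds)
         \<and> pattern_of (map snd ds) = \<sigma>
         \<and> (Max (fst ` set ds), Max (snd ` set ds)) \<in> boxes \<mu>)"

definition sym_count :: "nat list \<Rightarrow> nat list set \<Rightarrow> nat" where
  "sym_count \<mu> T =
     card {P. full_placement \<mu> P \<and> symmetric_dots P \<and> (\<forall>\<sigma> \<in> T. \<not> contains_pattern \<mu> P \<sigma>)}"

definition begins_with_12 :: "nat list \<Rightarrow> bool" where
  "begins_with_12 \<sigma> \<longleftrightarrow> is_pattern \<sigma> \<and> (\<exists>\<tau>. \<sigma> = [1, 2] @ \<tau>)"

definition replace_12_by_21 :: "nat list \<Rightarrow> nat list" where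
  "replace_12_by_21 \<sigma> = [2, 1] @ drop 2 \<sigma>"

lemma finite_boxes: "finite (boxes \<mu>)"
proof -
  have "boxes \<mu> \<subseteq> (\<Union>y \<in> {1..length \<mu>}. {1..\<mu> ! (y - 1)} \<times> {y})"
    by (auto simp: boxes_def)
  then show ?thesis by (rule finite_subset) auto
qed

text \<open>The set counted by \<^const>\<open>sym_count\<close> is finite, so \<^const>\<open>card\<close> is a genuine count.\<close>

lemma finite_full_placements: "finite {P. full_placement \<mu> P \<and> Q P}"
  by (rule finite_subset[of _ "Pow (boxes \<mu>)"])
     (auto simp: full_placement_def placement_def finite_boxes)

lemma pattern_of_order:
  assumes "i < length ys" "j < length ys"
  shows "pattern_of ys ! i < pattern_of ys ! j \<longleftrightarrow> ys ! i < ys ! j"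
proof -
  let ?r = "\<lambda>y. card {z \<in> set ys. z \<le> y}"
  have less: "?r a < ?r b" if "a < b" "b \<in> set ys" for a b
  proof (rule psubset_card_mono)
    have "b \<in> {z \<in> set ys. z \<le> b}" "b \<notin> {z \<in> set ys. z \<le> a}" using that by auto
    moreover have "{z \<in> set ys. z \<le> a} \<subseteq> {z \<in> set ys. z \<le> b}" using that by auto
    ultimately show "{z \<in> set ys. z \<le> a} \<subset> {z \<in> set ys. z \<le> b}" by blast
  qed simp
  have "?r (ys ! i) < ?r (ys ! j) \<longleftrightarrow> ys ! i < ys ! j"
    using less[of "ys ! i" "ys ! j"] less[of "ys ! j" "ys ! i"] assms
    by (cases "ys ! i" "ys ! j" rule: linorder_cases) simp_all
  then show ?thesis using assms by (simp add: pattern_of_def)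
qed

lemma is_pattern_pattern_of:
  assumes "distinct ys"
  shows "is_pattern (pattern_of ys)"
proof -
  have len: "length (pattern_of ys) = length ys" by (simp add: pattern_of_def)
  have d: "distinct (pattern_of ys)"
    unfolding distinct_conv_nth len
  proof (intro allI impI)
    fix i j assume ij: "i < length ys" "j < length ys" "i \<noteq> j"
    then have "ys ! i \<noteq> ys ! j" using assms by (simp add: nth_eq_iff_index_eq)
    then show "pattern_of ys ! i \<noteq> pattern_of ys ! j"
      using pattern_of_order[of i ys j] pattern_of_order[of j ys i] ij by linarith
  qed
  have "set (pattern_of ys) \<subseteq> {1..length ys}"
  proof
    fix r assume "r \<in> set (pattern_of ys)"
    then obtain y where y: "y \<in> set ys" "r = card {z \<in> set ys. z \<le> y}"
      by (auto simp: pattern_of_def)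
    have "r \<le> card (set ys)" unfolding y by (rule card_mono) auto
    moreover have "r > 0" unfolding y using y(1) by (subst card_gt_0_iff) auto
    ultimately show "r \<in> {1..length ys}"
      using card_length[of ys] by simp
  qed
  then have "set (pattern_of ys) = {1..length ys}"
    by (rule card_subset_eq[rotated]) (use d len in \<open>simp_all add: distinct_card\<close>)
  then show ?thesis using d len by (simp add: is_pattern_def)
qed

end

(* Let D be the set of boxes having, strictly to the north-east of them or of their transposes, a
   copy of the tail of one of the patterns.  A symmetric placement avoids T12 (T21) iff none of its
   increasing (decreasing) pairs of dots spans a rectangle with upper right corner in D.  Changing
   the dots inside D does not change D, since the tails that define the outer corners of D lie
   outside D.  Among the placements inside D occupying prescribed rows and columns there is, as soon
   as there is one at all, exactly one without increasing pairs and exactly one without decreasing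
   pairs: existence by minimising or maximising the sum of the products x * y, uniqueness by looking
   at the last column where two candidates differ.  By uniqueness these placements are symmetric.
   Exchanging one for the other is a bijection. *)
theory Submission
  imports Defs
begin

section \<open>Pairs of dots spanning a rectangle in a down-set\<close>

text \<open>The flag selects the prefix, \<open>True\<close> for 12 and \<open>False\<close> for 21,
  so that one argument serves both sides of the theorem.\<close>

definition ordered :: "bool \<Rightarrow> nat \<Rightarrow> nat \<Rightarrow> bool" where
  "ordered up a b \<longleftrightarrow> (if up then a < b else b < a)"

text \<open>As \<open>x1 < x2\<close>, the tested point is the upper right corner of the rectangle
  spanned by the two dots, for either value of \<open>up\<close>.\<close>

definition pair_free :: "bool \<Rightarrow> (nat \<times> nat) set \<Rightarrow> (nat \<times> nat) set \<Rightarrow> bool" where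
  "pair_free up D P \<longleftrightarrow>
     (\<forall>x1 y1 x2 y2. (x1, y1) \<in> P \<longrightarrow> (x2, y2) \<in> P \<longrightarrow> x1 < x2 \<longrightarrow> ordered up y1 y2
        \<longrightarrow> (x2, max y1 y2) \<notin> D)"

definition down_set :: "(nat \<times> nat) set \<Rightarrow> bool" where
  "down_set D \<longleftrightarrow> (\<forall>x y x' y'. (x, y) \<in> D \<longrightarrow> x' \<le> x \<longrightarrow> y' \<le> y \<longrightarrow> (x', y') \<in> D)"

lemma down_setD: "down_set D \<Longrightarrow> (x, y) \<in> D \<Longrightarrow> x' \<le> x \<Longrightarrow> y' \<le> y \<Longrightarrow> (x', y') \<in> D"
  unfolding down_set_def by blast

lemma pair_freeD:
  "pair_free up D P \<Longrightarrow> (x1, y1) \<in> P \<Longrightarrow> (x2, y2) \<in> P \<Longrightarrow> x1 < x2 \<Longrightarrow> ordered up y1 y2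
    \<Longrightarrow> (x2, max y1 y2) \<notin> D"
  unfolding pair_free_def by blast

lemma inj_on_fst_iff: "inj_on fst P \<longleftrightarrow> (\<forall>x y y'. (x, y) \<in> P \<longrightarrow> (x, y') \<in> P \<longrightarrow> y = y')"
  by (fastforce simp: inj_on_def)

lemma inj_on_snd_iff: "inj_on snd P \<longleftrightarrow> (\<forall>x x' y. (x, y) \<in> P \<longrightarrow> (x', y) \<in> P \<longrightarrow> x = x')"
  by (fastforce simp: inj_on_def)

text \<open>Reflection in the diagonal keeps increasing pairs increasing and decreasing pairs
  decreasing, but it reverses the left-to-right order of a decreasing pair; hence the two
  cases.\<close>

lemma pair_free_converse:
  assumes "pair_free up D P"
  shows "pair_free up (D\<inverse>) (P\<inverse>)"
  unfolding pair_free_def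
proof (intro allI impI)
  fix x1 y1 x2 y2
  assume h: "(x1, y1) \<in> P\<inverse>" "(x2, y2) \<in> P\<inverse>" "x1 < x2" "ordered up y1 y2"
  show "(x2, max y1 y2) \<notin> D\<inverse>"
  proof (cases up)
    case True
    then show ?thesis using pair_freeD[OF assms, of y1 x1 y2 x2] h by (simp add: ordered_def)
  next
    case False
    then show ?thesis using pair_freeD[OF assms, of y2 x2 y1 x1] h by (simp add: ordered_def)
  qed
qed

text \<open>Exchanging the rows of an offending pair stays inside \<open>D\<close>, since the corner
  of its rectangle is in \<open>D\<close>, and keeps the occupied rows and columns. The sum of the
  products of coordinates drops for an increasing pair and grows for a decreasing one; the sign in
  \<open>f\<close> makes both a decrease.\<close>

lemma ordered_pair_swap:
  fixes f :: "bool \<Rightarrow> nat \<times> nat \<Rightarrow> int"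
  defines "f \<equiv> \<lambda>up (x, y). (if up then 1 else -1) * (int x * int y)"
  assumes Q: "finite Q" "Q \<subseteq> D" "inj_on fst Q" "inj_on snd Q" and D: "down_set D"
    and p: "(x1, y1) \<in> Q" "(x2, y2) \<in> Q" "x1 < x2" "ordered up y1 y2" "(x2, max y1 y2) \<in> D"
  obtains Q' where "Q' \<subseteq> D" "inj_on fst Q'" "inj_on snd Q'" "fst ` Q' = fst ` Q" "snd ` Q' = snd ` Q"
    "sum (f up) Q' < sum (f up) Q"
proof -
  define R where "R = Q - {(x1, y1), (x2, y2)}"
  define Q' where "Q' = insert (x1, y2) (insert (x2, y1) R)"
  have ne: "y1 \<noteq> y2" using p(4) by (auto simp: ordered_def split: if_splits)
  have QR: "Q = insert (x1, y1) (insert (x2, y2) R)" using p R_def by blast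
  \<comment> \<open>Injectivity leaves no other dot in the two columns and two rows of the pair, so
    the swapped dots collide with nothing in \<open>R\<close>.\<close>
  have new: "(x1, b) \<notin> R" "(x2, b) \<notin> R" "(a, y1) \<notin> R" "(a, y2) \<notin> R" for a b
    using Q(3,4) p ne unfolding inj_on_fst_iff inj_on_snd_iff R_def by blast+
  have inD: "(x1, y2) \<in> D" "(x2, y1) \<in> D" using down_setD[OF D p(5)] p(3) by auto
  have R: "finite R" "R \<subseteq> D" "inj_on fst R" "inj_on snd R"
    using Q by (auto simp: R_def intro: inj_on_subset)
  show ?thesis
  proof
    show "Q' \<subseteq> D" using inD R by (simp add: Q'_def)
    show "inj_on fst Q'" "inj_on snd Q'"
      using R(3,4) new ne p(3) unfolding Q'_def inj_on_fst_iff inj_on_snd_iff by auto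
    show "fst ` Q' = fst ` Q" "snd ` Q' = snd ` Q" unfolding Q'_def QR by auto
    have "(int x2 - int x1) * (int y2 - int y1) * (if up then 1 else -1) > 0"
      using p(3,4) by (auto simp: ordered_def zero_less_mult_iff mult_less_0_iff split: if_splits)
    then have "f up (x1, y2) + f up (x2, y1) < f up (x1, y1) + f up (x2, y2)"
      by (simp add: f_def algebra_simps split: if_splits)
    moreover have "sum (f up) Q' = f up (x1, y2) + f up (x2, y1) + sum (f up) R"
      unfolding Q'_def using R(1) new p(3) by simp
    moreover have "sum (f up) Q = f up (x1, y1) + f up (x2, y2) + sum (f up) R"
      unfolding QR using R(1) new p(3) by simp
    ultimately show "sum (f up) Q' < sum (f up) Q" by simp
  qed
qed

text \<open>A rearrangement of least weight has no offending pair, for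
  \<open>ordered_pair_swap\<close> would produce a lighter one.\<close>

lemma pair_free_exists:
  assumes Q: "finite Q" "Q \<subseteq> D" "inj_on fst Q" "inj_on snd Q" and D: "down_set D"
  obtains Q' where "Q' \<subseteq> D" "inj_on fst Q'" "inj_on snd Q'" "fst ` Q' = fst ` Q" "snd ` Q' = snd ` Q"
    "pair_free up D Q'"
proof -
  define C where "C = {Q'. Q' \<subseteq> D \<and> inj_on fst Q' \<and> inj_on snd Q' \<and> fst ` Q' = fst ` Q \<and> snd ` Q' = snd ` Q}"
  define f :: "nat \<times> nat \<Rightarrow> int" where "f = (\<lambda>(x, y). (if up then 1 else -1) * (int x * int y))"
  \<comment> \<open>Candidates live in the finite grid of prescribed columns and rows;
    \<open>D\<close> itself may be infinite.\<close>
  have "C \<subseteq> Pow (fst ` Q \<times> snd ` Q)"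
  proof (intro subsetI PowI)
    fix Q' d assume "Q' \<in> C" "d \<in> Q'"
    then have "fst d \<in> fst ` Q" "snd d \<in> snd ` Q" unfolding C_def by blast+
    then show "d \<in> fst ` Q \<times> snd ` Q" by (simp add: mem_Times_iff)
  qed
  then have finC: "finite C" by (rule finite_subset) (use Q in simp)
  have "Q \<in> C" using Q by (simp add: C_def)
  then obtain Q' where Q': "Q' \<in> C" and min: "\<And>Q''. Q'' \<in> C \<Longrightarrow> \<not> sum f Q'' < sum f Q'"
    using ex_min_if_finite[of "sum f ` C"] finC by blast
  have finQ': "finite Q'" using Q' Q(1) finite_imageD[of fst Q'] by (simp add: C_def)
  have "pair_free up D Q'"
    unfolding pair_free_def
  proof (intro allI impI notI)
    fix x1 y1 x2 y2
    assume "(x1, y1) \<in> Q'" "(x2, y2) \<in> Q'" "x1 < x2" "ordered up y1 y2" "(x2, max y1 y2) \<in> D"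
    moreover have "Q' \<subseteq> D" "inj_on fst Q'" "inj_on snd Q'" using Q' by (simp_all add: C_def)
    ultimately obtain Q'' where Q'': "Q'' \<subseteq> D" "inj_on fst Q''" "inj_on snd Q''" "fst ` Q'' = fst ` Q'"
        "snd ` Q'' = snd ` Q'" and less: "sum f Q'' < sum f Q'"
      using ordered_pair_swap[OF finQ' _ _ _ D] unfolding f_def by metis
    have "Q'' \<in> C" using Q'' Q' by (simp add: C_def)
    then show False using min less by blast
  qed
  then show thesis using Q' by (intro that[of Q']) (simp_all add: C_def)
qed

text \<open>A row used in column \<open>c\<close> by only one of the two sets must be filled by the
  other to the left of \<open>c\<close>, as they agree to the right. Row \<open>r\<close> thus gives
  \<open>Q'\<close> an increasing pair ending at \<open>(c, r')\<close>, and row \<open>r'\<close>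
  gives \<open>Q\<close> a decreasing pair ending at \<open>(c, r)\<close>. Both rectangles have the
  corner \<open>(c, r')\<close>, which lies in \<open>D\<close>; \<open>up\<close> decides which
  pair is the forbidden one.\<close>

lemma pair_free_unique_aux:
  assumes D: "down_set D"
    and Q: "Q \<subseteq> D" "inj_on fst Q" "inj_on snd Q" "pair_free up D Q"
    and Q': "Q' \<subseteq> D" "inj_on fst Q'" "inj_on snd Q'" "pair_free up D Q'"
    and rows: "snd ` Q = snd ` Q'"
    and c: "(c, r) \<in> Q" "(c, r') \<in> Q'" "r < r'"
    and above: "\<And>x y. c < x \<Longrightarrow> (x, y) \<in> Q \<longleftrightarrow> (x, y) \<in> Q'"
  shows False
proof -
  have corner: "(c, r') \<in> D" using Q' c by blast
  show False
  proof (cases up)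
    case True
    obtain x where x: "(x, r) \<in> Q'" using rows c(1) by force
    have "x \<noteq> c" using x c Q'(2) unfolding inj_on_fst_iff by blast
    moreover have "\<not> c < x" using above[of x r] x c(1) Q(3) unfolding inj_on_snd_iff by blast
    ultimately have "x < c" by simp
    then show False using pair_freeD[OF Q'(4) x c(2)] True c(3) corner by (simp add: ordered_def)
  next
    case False
    obtain x where x: "(x, r') \<in> Q" using rows c(2) by force
    have "x \<noteq> c" using x c Q(2) unfolding inj_on_fst_iff by blast
    moreover have "\<not> c < x" using above[of x r'] x c(2) Q'(3) unfolding inj_on_snd_iff by blast
    ultimately have "x < c" by simp
    then show False using pair_freeD[OF Q(4) x c(1)] False c(3) corner by (simp add: ordered_def)
  qed
qed

lemma pair_free_unique:
  assumes D: "down_set D" and fin: "finite Q"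
    and Q: "Q \<subseteq> D" "inj_on fst Q" "inj_on snd Q" "pair_free up D Q"
    and Q': "Q' \<subseteq> D" "inj_on fst Q'" "inj_on snd Q'" "pair_free up D Q'"
    and cols: "fst ` Q = fst ` Q'" and rows: "snd ` Q = snd ` Q'"
  shows "Q = Q'"
proof -
  define M where "M = {x. \<exists>y y'. (x, y) \<in> Q \<and> (x, y') \<in> Q' \<and> y \<noteq> y'}"
  have "M \<subseteq> fst ` Q" by (force simp: M_def)
  then have finM: "finite M" using fin by (simp add: finite_subset)
  have eq_iff: "(x, y) \<in> Q \<longleftrightarrow> (x, y) \<in> Q'" if "x \<notin> M" for x y
  proof
    assume q: "(x, y) \<in> Q"
    then obtain y' where "(x, y') \<in> Q'" using cols by force
    then show "(x, y) \<in> Q'" using q that by (auto simp: M_def)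
  next
    assume q: "(x, y) \<in> Q'"
    then obtain y' where "(x, y') \<in> Q" using cols by force
    then show "(x, y) \<in> Q" using q that by (auto simp: M_def)
  qed
  have "M = {}"
  proof (rule ccontr)
    assume "M \<noteq> {}"
    \<comment> \<open>The last column of disagreement supplies agreement to its right; the set with
      the lower dot there plays the role of \<open>Q\<close> in the auxiliary lemma.\<close>
    define c where "c = Max M"
    have "c \<in> M" using finM \<open>M \<noteq> {}\<close> by (simp add: c_def)
    then obtain r r' where c: "(c, r) \<in> Q" "(c, r') \<in> Q'" "r \<noteq> r'" by (auto simp: M_def)
    have above: "(x, y) \<in> Q \<longleftrightarrow> (x, y) \<in> Q'" if "c < x" for x y
      using that Max_ge[OF finM, of x] by (intro eq_iff notI) (simp add: c_def)
    consider "r < r'" | "r' < r" using c(3) by linarith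
    then show False
    proof cases
      case 1
      then show False by (rule pair_free_unique_aux[OF D Q Q' rows c(1,2)]) (rule above)
    next
      case 2
      then show False
        by (rule pair_free_unique_aux[OF D Q' Q rows[symmetric] c(2,1)]) (simp add: above)
    qed
  qed
  then show ?thesis using eq_iff by auto
qed

section \<open>Boxes dominated by a tail of a pattern\<close>

text \<open>The tails concerned are orderings of 3, ..., k, hence the shift by 2. The box
  \<open>(X, Y)\<close> witnesses the rectangular subshape; for an empty tail the bounds
  \<open>x \<le> X\<close> and \<open>y \<le> Y\<close> alone tie the point to the shape. Points
  with a zero coordinate may belong to this set.\<close>

definition dominated :: "nat list \<Rightarrow> nat list set \<Rightarrow> (nat \<times> nat) set \<Rightarrow> (nat \<times> nat) set" where
  "dominated \<mu> S P = {(x, y). \<exists>es X Y. set es \<subseteq> P \<and> sorted_wrt (<) (map fst es)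
     \<and> map (\<lambda>t. t + 2) (pattern_of (map snd es)) \<in> S
     \<and> (X, Y) \<in> boxes \<mu> \<and> x \<le> X \<and> y \<le> Y
     \<and> (\<forall>(a, b) \<in> set es. x < a \<and> a \<le> X \<and> y < b \<and> b \<le> Y)}"

text \<open>Adding the transposes makes the region symmetric, so that uniqueness can force the
  rearranged dots inside it to be symmetric too.\<close>

definition sym_dominated :: "nat list \<Rightarrow> nat list set \<Rightarrow> (nat \<times> nat) set \<Rightarrow> (nat \<times> nat) set" where
  "sym_dominated \<mu> S P = dominated \<mu> S P \<union> (dominated \<mu> S P)\<inverse>"

lemma boxes_mono:
  assumes "shape \<mu>" "(X, Y) \<in> boxes \<mu>" "1 \<le> x" "x \<le> X" "1 \<le> y" "y \<le> Y"
  shows "(x, y) \<in> boxes \<mu>"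
proof -
  have "\<mu> ! (Y - 1) \<le> \<mu> ! (y - 1)"
  proof (cases "y = Y")
    case False
    then show ?thesis using assms unfolding shape_def boxes_def
      by (auto simp: sorted_wrt_iff_nth_less)
  qed simp
  then show ?thesis using assms by (auto simp: boxes_def)
qed

lemma dominated_mono:
  assumes "(x, y) \<in> dominated \<mu> S P" "x' \<le> x" "y' \<le> y"
  shows "(x', y') \<in> dominated \<mu> S P"
proof -
  obtain es X Y where "set es \<subseteq> P" "sorted_wrt (<) (map fst es)"
      "map (\<lambda>t. t + 2) (pattern_of (map snd es)) \<in> S"
      "(X, Y) \<in> boxes \<mu>" "x \<le> X" "y \<le> Y" "\<forall>(a, b) \<in> set es. x < a \<and> a \<le> X \<and> y < b \<and> b \<le> Y"
    using assms(1) unfolding dominated_def by blast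
  moreover have "\<forall>(a, b) \<in> set es. x' < a \<and> a \<le> X \<and> y' < b \<and> b \<le> Y"
    using calculation(7) assms(2,3) by fastforce
  moreover have "x' \<le> X" "y' \<le> Y" using calculation(5,6) assms(2,3) by auto
  ultimately show ?thesis unfolding dominated_def by blast
qed

lemma down_set_sym_dominated: "down_set (sym_dominated \<mu> S P)"
  unfolding down_set_def sym_dominated_def Un_iff converse_iff
  by (blast intro: dominated_mono)

lemma converse_sym_dominated: "(sym_dominated \<mu> S P)\<inverse> = sym_dominated \<mu> S P"
  by (auto simp: sym_dominated_def)

lemma dominated_bound:
  assumes "(x, y) \<in> dominated \<mu> S P"
  obtains X Y where "(X, Y) \<in> boxes \<mu>" "x \<le> X" "y \<le> Y"
proof -
  have "\<exists>X Y. (X, Y) \<in> boxes \<mu> \<and> x \<le> X \<and> y \<le> Y"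
    using assms unfolding dominated_def mem_Collect_eq prod.case by blast
  then show thesis using that by blast
qed

lemma finite_sym_dominated: "finite (sym_dominated \<mu> S P)"
proof -
  have "dominated \<mu> S P \<subseteq> (\<Union>(X, Y) \<in> boxes \<mu>. {..X} \<times> {..Y})"
    by (fastforce elim: dominated_bound)
  then have "finite (dominated \<mu> S P)"
    by (rule finite_subset) (auto simp: finite_boxes)
  then show ?thesis by (simp add: sym_dominated_def)
qed

text \<open>Only the dots strictly north-east of a point enter its domination condition.\<close>

lemma dominated_transfer:
  assumes "(x, y) \<in> dominated \<mu> S P" "\<And>a b. (a, b) \<in> P \<Longrightarrow> x < a \<Longrightarrow> y < b \<Longrightarrow> (a, b) \<in> P'"
  shows "(x, y) \<in> dominated \<mu> S P'"
proof -
  obtain es X Y where es: "set es \<subseteq> P" "sorted_wrt (<) (map fst es)"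
      "map (\<lambda>t. t + 2) (pattern_of (map snd es)) \<in> S"
      "(X, Y) \<in> boxes \<mu>" "x \<le> X" "y \<le> Y" "\<forall>(a, b) \<in> set es. x < a \<and> a \<le> X \<and> y < b \<and> b \<le> Y"
    using assms(1) unfolding dominated_def by blast
  moreover have "set es \<subseteq> P'" using es(1,7) assms(2) by fastforce
  ultimately show ?thesis unfolding dominated_def by blast
qed

text \<open>All dots strictly north-east of a point outside the region are outside too, where
  \<open>P\<close> and \<open>P'\<close> agree, so the region cannot grow. It cannot shrink, because
  each of its points lies weakly below one whose witnessing tail lies outside the region.\<close>

lemma sym_dominated_cong:
  assumes diff: "P' - sym_dominated \<mu> S P = P - sym_dominated \<mu> S P"
  shows "sym_dominated \<mu> S P' = sym_dominated \<mu> S P"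
proof
  let ?D = "sym_dominated \<mu> S P"
  have flip: "(b, a) \<in> ?D" if "(a, b) \<in> ?D" for a b
    using that converse_sym_dominated by blast
  show "sym_dominated \<mu> S P' \<subseteq> ?D"
  proof -
    have "(x, y) \<in> ?D" if "(x, y) \<in> dominated \<mu> S P'" for x y
    proof (rule ccontr)
      assume n: "(x, y) \<notin> ?D"
      have "(x, y) \<in> dominated \<mu> S P"
      proof (rule dominated_transfer[OF that])
        fix a b assume ab: "(a, b) \<in> P'" "x < a" "y < b"
        then have "(a, b) \<notin> ?D"
          using n down_setD[OF down_set_sym_dominated, of a b \<mu> S P x y] by auto
        then show "(a, b) \<in> P" using ab(1) diff by blast
      qed
      then show False using n by (simp add: sym_dominated_def)
    qed
    then show ?thesis using flip by (auto simp: sym_dominated_def[of \<mu> S P'])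
  qed
  show "?D \<subseteq> sym_dominated \<mu> S P'"
  proof
    fix d assume d: "d \<in> ?D"
    \<comment> \<open>A point of largest coordinate sum in \<open>E\<close> has no point of the
      region strictly north-east of it.\<close>
    define E where "E = {(a, b) \<in> ?D. fst d \<le> a \<and> snd d \<le> b}"
    have "finite E" by (rule finite_subset[OF _ finite_sym_dominated]) (auto simp: E_def)
    moreover have "d \<in> E" using d by (auto simp: E_def)
    ultimately have "Max ((\<lambda>e. fst e + snd e) ` E) \<in> (\<lambda>e. fst e + snd e) ` E"
      and "\<And>e. e \<in> E \<Longrightarrow> fst e + snd e \<le> Max ((\<lambda>e. fst e + snd e) ` E)"
      by (auto intro: Max_in)
    then obtain m where m: "m \<in> E" and max: "\<And>e. e \<in> E \<Longrightarrow> fst e + snd e \<le> fst m + snd m"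
      by (auto simp: image_iff)
    obtain x y where xy: "m = (x, y)" by (cases m)
    have mD: "(x, y) \<in> ?D" "fst d \<le> x" "snd d \<le> y" using m by (auto simp: E_def xy)
    have beyond: "(a, b) \<notin> ?D" if "x < a" "y < b" for a b
      using that max[of "(a, b)"] mD by (auto simp: E_def xy)
    have "(x, y) \<in> sym_dominated \<mu> S P'"
    proof (cases "(x, y) \<in> dominated \<mu> S P")
      case True
      then have "(x, y) \<in> dominated \<mu> S P'"
        by (rule dominated_transfer) (use beyond diff in blast)
      then show ?thesis by (simp add: sym_dominated_def)
    next
      case False
      then have "(y, x) \<in> dominated \<mu> S P" using mD(1) by (simp add: sym_dominated_def)
      then have "(y, x) \<in> dominated \<mu> S P'"
        by (rule dominated_transfer) (use beyond diff flip in blast)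
      then show ?thesis by (simp add: sym_dominated_def)
    qed
    then show "d \<in> sym_dominated \<mu> S P'"
      using down_setD[OF down_set_sym_dominated, of x y \<mu> S P' "fst d" "snd d"] mD(2,3) by simp
  qed
qed

text \<open>For symmetric \<open>P\<close>, reflection carries the condition for
  \<open>dominated\<close> to the one for its transpose, and being pair-free for a union means being
  so for both parts.\<close>

lemma pair_free_sym_dominated:
  assumes "symmetric_dots P"
  shows "pair_free up (sym_dominated \<mu> S P) P \<longleftrightarrow> pair_free up (dominated \<mu> S P) P"
proof -
  have "P\<inverse> = P" using assms by (auto simp: symmetric_dots_def)
  then have "pair_free up ((dominated \<mu> S P)\<inverse>) P" if "pair_free up (dominated \<mu> S P) P"
    using pair_free_converse[OF that] by simp
  then show ?thesis by (auto simp: sym_dominated_def pair_free_def)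
qed

section \<open>Patterns with an exchangeable prefix\<close>

definition prefix12 :: "bool \<Rightarrow> nat list" where
  "prefix12 up = (if up then [1, 2] else [2, 1])"

text \<open>The two least entries take the ranks 1 and 2 and raise every other rank by 2.\<close>

lemma pattern_of_prefix:
  assumes "y1 \<noteq> y2" "\<forall>y \<in> set ys. max y1 y2 < y"
  shows "pattern_of (y1 # y2 # ys) = prefix12 (y1 < y2) @ map (\<lambda>t. t + 2) (pattern_of ys)"
proof -
  let ?Z = "set (y1 # y2 # ys)"
  have "{z \<in> ?Z. z \<le> y} = insert y1 (insert y2 {z \<in> set ys. z \<le> y})" if "y \<in> set ys" for y
    using that assms(2) by auto
  moreover have "y1 \<notin> set ys" "y2 \<notin> set ys" using assms(2) by auto
  ultimately have "card {z \<in> ?Z. z \<le> y} = card {z \<in> set ys. z \<le> y} + 2" if "y \<in> set ys" for y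
    using that assms(1) by simp
  moreover have "{z \<in> ?Z. z \<le> y1} = (if y1 < y2 then {y1} else {y1, y2})"
    "{z \<in> ?Z. z \<le> y2} = (if y1 < y2 then {y1, y2} else {y2})"
    using assms by auto
  ultimately show ?thesis using assms(1) by (auto simp: pattern_of_def prefix12_def)
qed

text \<open>Comparisons carry over between a sequence and its pattern by
  \<open>pattern_of_order\<close>, so a tail with entries above 2 forces the first two values to lie
  below all others.\<close>

lemma pattern_of_prefixD:
  assumes eq: "pattern_of ys = prefix12 up @ \<tau>" and \<tau>: "\<forall>t \<in> set \<tau>. 2 < t"
  obtains y1 y2 zs where "ys = y1 # y2 # zs" "ordered up y1 y2" "\<forall>z \<in> set zs. max y1 y2 < z"
    "\<tau> = map (\<lambda>t. t + 2) (pattern_of zs)"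
proof -
  have len: "length ys = length \<tau> + 2"
    using arg_cong[OF eq, of length] by (simp add: pattern_of_def prefix12_def split: if_splits)
  then obtain y1 y2 zs where ys: "ys = y1 # y2 # zs"
    by (metis Suc_length_conv add_2_eq_Suc')
  have less: "(prefix12 up @ \<tau>) ! i < (prefix12 up @ \<tau>) ! j \<longleftrightarrow> ys ! i < ys ! j"
    if "i < length ys" "j < length ys" for i j
    using pattern_of_order[OF that] by (simp add: eq)
  have o: "ordered up y1 y2"
    using less[of 0 1] less[of 1 0] by (auto simp: ordered_def prefix12_def ys split: if_splits)
  have "y1 < z \<and> y2 < z" if z: "z \<in> set zs" for z
  proof -
    obtain i where i: "i < length zs" "z = zs ! i" using z by (auto simp: in_set_conv_nth)
    then have "2 < \<tau> ! i" using \<tau> len ys by simp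
    then show ?thesis using less[of 0 "i + 2"] less[of 1 "i + 2"] i
      by (auto simp: prefix12_def ys split: if_splits)
  qed
  then have b: "\<forall>z \<in> set zs. max y1 y2 < z" by simp
  have ne: "y1 \<noteq> y2" using o by (auto simp: ordered_def split: if_splits)
  have "\<tau> = map (\<lambda>t. t + 2) (pattern_of zs)"
    using pattern_of_prefix[OF ne b] eq ys by (auto simp: prefix12_def split: if_splits)
  then show thesis using that ys o b by blast
qed

text \<open>A copy of \<open>prefix12 up @ \<tau>\<close> splits into an ordered pair of dots and a
  copy of the tail strictly north-east of the corner of its rectangle, all within one rectangular
  subshape; this says that the corner is dominated.\<close>

lemma contains_pattern_iff:
  assumes "shape \<mu>" and P: "P \<subseteq> boxes \<mu>" and S: "\<forall>\<tau> \<in> S. \<forall>t \<in> set \<tau>. 2 < t"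
  shows "(\<forall>\<tau> \<in> S. \<not> contains_pattern \<mu> P (prefix12 up @ \<tau>)) \<longleftrightarrow> pair_free up (dominated \<mu> S P) P"
proof (intro iffI)
  assume avoids: "\<forall>\<tau> \<in> S. \<not> contains_pattern \<mu> P (prefix12 up @ \<tau>)"
  show "pair_free up (dominated \<mu> S P) P"
    unfolding pair_free_def
  proof (intro allI impI notI)
    fix x1 y1 x2 y2
    assume d: "(x1, y1) \<in> P" "(x2, y2) \<in> P" "x1 < x2" "ordered up y1 y2"
      "(x2, max y1 y2) \<in> dominated \<mu> S P"
    obtain es X Y where es: "set es \<subseteq> P" "sorted_wrt (<) (map fst es)"
      "map (\<lambda>t. t + 2) (pattern_of (map snd es)) \<in> S"
      "(X, Y) \<in> boxes \<mu>" "x2 \<le> X" "max y1 y2 \<le> Y"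
      "\<forall>(a, b) \<in> set es. x2 < a \<and> a \<le> X \<and> max y1 y2 < b \<and> b \<le> Y"
      using d(5) unfolding dominated_def by blast
    define ds where "ds = (x1, y1) # (x2, y2) # es"
    have "pattern_of (y1 # y2 # map snd es)
        = prefix12 (y1 < y2) @ map (\<lambda>t. t + 2) (pattern_of (map snd es))"
      using d(4) es(7) by (intro pattern_of_prefix) (auto simp: ordered_def split: if_splits)
    moreover have "prefix12 (y1 < y2) = prefix12 up"
      using d(4) by (auto simp: ordered_def split: if_splits)
    ultimately have pat: "pattern_of (map snd ds)
        = prefix12 up @ map (\<lambda>t. t + 2) (pattern_of (map snd es))" by (simp add: ds_def)
    have sub: "set ds \<subseteq> P" using d es(1) by (simp add: ds_def)
    have "sorted_wrt (<) (map fst ds)" using d(3) es(2,7) by (fastforce simp: ds_def)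
    moreover have "length ds = length (prefix12 up @ map (\<lambda>t. t + 2) (pattern_of (map snd es)))"
      using arg_cong[OF pat, of length] by (simp add: pattern_of_def)
    moreover have "(Max (fst ` set ds), Max (snd ` set ds)) \<in> boxes \<mu>"
    proof (rule boxes_mono[OF assms(1) es(4)])
      have "1 \<le> x1" "1 \<le> y1" using d(1) P by (auto simp: boxes_def)
      then show "1 \<le> Max (fst ` set ds)" "1 \<le> Max (snd ` set ds)"
        by (auto simp: ds_def Max_ge_iff)
      show "Max (fst ` set ds) \<le> X" "Max (snd ` set ds) \<le> Y"
        using d(3) es(5,6,7) by (auto simp: ds_def)
    qed
    ultimately have "contains_pattern \<mu> P (prefix12 up @ map (\<lambda>t. t + 2) (pattern_of (map snd es)))"
      unfolding contains_pattern_def using pat sub by blast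
    then show False using avoids es(3) by blast
  qed
next
  assume free: "pair_free up (dominated \<mu> S P) P"
  show "\<forall>\<tau> \<in> S. \<not> contains_pattern \<mu> P (prefix12 up @ \<tau>)"
  proof (intro ballI notI)
    fix \<tau> assume \<tau>: "\<tau> \<in> S" and "contains_pattern \<mu> P (prefix12 up @ \<tau>)"
    then obtain ds where ds: "set ds \<subseteq> P" "sorted_wrt (<) (map fst ds)"
        "pattern_of (map snd ds) = prefix12 up @ \<tau>"
        "(Max (fst ` set ds), Max (snd ` set ds)) \<in> boxes \<mu>"
      unfolding contains_pattern_def by blast
    obtain y1 y2 zs where ys: "map snd ds = y1 # y2 # zs" "ordered up y1 y2"
        "\<forall>z \<in> set zs. max y1 y2 < z" "\<tau> = map (\<lambda>t. t + 2) (pattern_of zs)"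
      using pattern_of_prefixD[OF ds(3)] S \<tau> by metis
    then obtain x1 x2 es where split: "ds = (x1, y1) # (x2, y2) # es" "map snd es = zs"
      by (auto simp: map_eq_Cons_conv)
    \<comment> \<open>The corner of the bounding rectangle of the whole occurrence serves as the box
      \<open>(X, Y)\<close>; \<open>ds\<close> is nonempty, so the maxima are genuine.\<close>
    let ?X = "Max (fst ` set ds)" and ?Y = "Max (snd ` set ds)"
    have le: "a \<le> ?X \<and> b \<le> ?Y" if "(a, b) \<in> set ds" for a b
      using that by (force intro: Max_ge)
    have "(x2, max y1 y2) \<in> dominated \<mu> S P"
    proof -
      have "set es \<subseteq> P" "sorted_wrt (<) (map fst es)" using ds split by auto
      moreover have "map (\<lambda>t. t + 2) (pattern_of (map snd es)) \<in> S" using ys split \<tau> by simp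
      moreover have "x2 \<le> ?X" "max y1 y2 \<le> ?Y" using le split(1) by auto
      moreover have "\<forall>(a, b) \<in> set es. x2 < a \<and> a \<le> ?X \<and> max y1 y2 < b \<and> b \<le> ?Y"
      proof (intro ballI, clarify)
        fix a b assume ab: "(a, b) \<in> set es"
        have "x2 < a" using ds(2) ab split(1) by force
        moreover have "max y1 y2 < b" using ys(3) ab split(2) by force
        ultimately show "x2 < a \<and> a \<le> ?X \<and> max y1 y2 < b \<and> b \<le> ?Y" using le[of a b] ab split(1) by simp
      qed
      ultimately show ?thesis unfolding dominated_def using ds(4) by blast
    qed
    moreover have "(x1, y1) \<in> P" "(x2, y2) \<in> P" "x1 < x2" using ds split by auto
    ultimately show False using pair_freeD[OF free] ys(2) by blast
  qed
qed

section \<open>Exchanging the dots inside the dominated region\<close>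

text \<open>Fullness as equality of projections is visibly preserved by an exchange that keeps the
  occupied rows and columns.\<close>

lemma full_placement_iff:
  "full_placement \<mu> P \<longleftrightarrow> P \<subseteq> boxes \<mu> \<and> inj_on fst P \<and> inj_on snd P
     \<and> fst ` P = fst ` boxes \<mu> \<and> snd ` P = snd ` boxes \<mu>"
proof -
  have ex1: "(\<forall>x \<in> f ` B. \<exists>!d. d \<in> P \<and> f d = x) \<longleftrightarrow> f ` P = f ` B"
    if "P \<subseteq> B" "inj_on f P" for B and f :: "nat \<times> nat \<Rightarrow> nat"
  proof
    assume ex1: "\<forall>x \<in> f ` B. \<exists>!d. d \<in> P \<and> f d = x"
    have "f ` B \<subseteq> f ` P"
    proof
      fix x assume "x \<in> f ` B"
      then obtain d where "d \<in> P" "f d = x" using bspec[OF ex1] by blast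
      then show "x \<in> f ` P" by blast
    qed
    then show "f ` P = f ` B" using that(1) by (simp add: image_mono subset_antisym)
  next
    assume "f ` P = f ` B"
    then have "\<exists>d. d \<in> P \<and> f d = x" if "x \<in> f ` B" for x
      using that by (metis imageE)
    then show "\<forall>x \<in> f ` B. \<exists>!d. d \<in> P \<and> f d = x"
      using inj_onD[OF that(2)] by (intro ballI ex_ex1I) auto
  qed
  show ?thesis
  proof (cases "P \<subseteq> boxes \<mu> \<and> inj_on fst P \<and> inj_on snd P")
    case True
    then show ?thesis
      unfolding full_placement_def placement_def by (simp only: ex1[of "boxes \<mu>"] simp_thms)
  next
    case False
    then show ?thesis unfolding full_placement_def placement_def by blast
  qed
qed

text \<open>The forbidden region depends on the placement itself, so an exchange of dots has to
  leave this region unchanged.\<close>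

definition sym_free :: "nat list \<Rightarrow> nat list set \<Rightarrow> bool \<Rightarrow> (nat \<times> nat) set set" where
  "sym_free \<mu> S up =
     {P. full_placement \<mu> P \<and> symmetric_dots P \<and> pair_free up (sym_dominated \<mu> S P) P}"

definition same_outside :: "(nat \<times> nat) set \<Rightarrow> (nat \<times> nat) set \<Rightarrow> (nat \<times> nat) set \<Rightarrow> bool" where
  "same_outside D P P' \<longleftrightarrow> P' - D = P - D \<and> fst ` (P' \<inter> D) = fst ` (P \<inter> D) \<and> snd ` (P' \<inter> D) = snd ` (P \<inter> D)"

text \<open>If the corner of a rectangle lies in a down-set, so do both dots; hence only dots inside
  \<open>D\<close> matter.\<close>

lemma pair_free_Int:
  assumes "down_set D"
  shows "pair_free up D (P \<inter> D) \<longleftrightarrow> pair_free up D P"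
proof -
  have "(x1, y1) \<in> D \<and> (x2, y2) \<in> D" if "x1 < x2" "(x2, max y1 y2) \<in> D" for x1 y1 x2 y2
    using down_setD[OF assms that(2)] that(1) by auto
  then show ?thesis unfolding pair_free_def by blast
qed

text \<open>By injectivity on \<open>P\<close>, the values at the remaining dots avoid those at the
  removed ones, which are exactly the values on \<open>Q\<close>.\<close>

lemma inj_on_exchange:
  assumes "inj_on f P" "inj_on f Q" "f ` Q = f ` (P \<inter> D)"
  shows "inj_on f ((P - D) \<union> Q)"
proof -
  have "f ` (P - D) \<inter> f ` Q = {}" unfolding assms(3) using assms(1) by (auto dest: inj_onD)
  then have "f ` (P - D - Q) \<inter> f ` (Q - (P - D)) = {}" by blast
  then show ?thesis unfolding inj_on_Un using assms(1,2) by (simp add: inj_on_diff)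
qed

lemma sym_free_exchange:
  assumes "shape \<mu>" and sc: "self_conjugate \<mu>" and P: "P \<in> sym_free \<mu> S up"
  obtains P' where "P' \<in> sym_free \<mu> S up'" "sym_dominated \<mu> S P' = sym_dominated \<mu> S P"
    "same_outside (sym_dominated \<mu> S P) P P'"
proof -
  define D where "D = sym_dominated \<mu> S P"
  have D: "down_set D" "D\<inverse> = D" by (simp_all add: D_def down_set_sym_dominated converse_sym_dominated)
  have full: "P \<subseteq> boxes \<mu>" "inj_on fst P" "inj_on snd P" "fst ` P = fst ` boxes \<mu>"
      "snd ` P = snd ` boxes \<mu>" and symP: "P\<inverse> = P"
    using P by (auto simp: sym_free_def full_placement_iff symmetric_dots_def)
  have finP: "finite P" using full(1) finite_boxes finite_subset by blast
  obtain Q where Q: "Q \<subseteq> D" "inj_on fst Q" "inj_on snd Q" "fst ` Q = fst ` (P \<inter> D)"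
      "snd ` Q = snd ` (P \<inter> D)" "pair_free up' D Q"
  proof (rule pair_free_exists[of "P \<inter> D" D up'])
    show "inj_on fst (P \<inter> D)" "inj_on snd (P \<inter> D)" using full by (auto intro: inj_on_subset)
  qed (use finP D in auto)
  have finQ: "finite Q" using Q(2,4) finP finite_imageD[of fst Q] by simp
  \<comment> \<open>Since \<open>P\<close> and \<open>D\<close> are symmetric, the reflected
    \<open>Q\<close> solves the same rearrangement problem, so uniqueness identifies the
    two.\<close>
  have symQ: "Q\<inverse> = Q"
  proof -
    have im: "fst ` (R\<inverse>) = snd ` R" "snd ` (R\<inverse>) = fst ` R" for R :: "(nat \<times> nat) set" by force+
    have "(P \<inter> D)\<inverse> = P \<inter> D" using symP D(2) by (simp add: converse_Int)
    then have "fst ` (P \<inter> D) = snd ` (P \<inter> D)" using im(1)[of "P \<inter> D"] by simp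
    moreover have "Q\<inverse> \<subseteq> D" using Q(1) D(2) by blast
    moreover have "inj_on fst (Q\<inverse>)" "inj_on snd (Q\<inverse>)"
      using Q(2,3) unfolding inj_on_fst_iff inj_on_snd_iff by blast+
    moreover have "pair_free up' D (Q\<inverse>)" using pair_free_converse[OF Q(6)] D(2) by simp
    ultimately show ?thesis
      using Q finQ im[of Q] by (intro pair_free_unique[of D "Q\<inverse>" up' Q]) (simp_all add: D)
  qed
  define P' where "P' = (P - D) \<union> Q"
  have diff: "P' - D = P - D" and int: "P' \<inter> D = Q" using Q(1) by (auto simp: P'_def)
  have D': "sym_dominated \<mu> S P' = D"
    using sym_dominated_cong[of P' \<mu> S P] diff by (simp add: D_def)
  \<comment> \<open>\<open>D\<close> may contain points with a zero coordinate, so positivity is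
    read off from the rows and columns used by \<open>P\<close>. Self-conjugacy handles points
    dominated only after transposition.\<close>
  have "Q \<subseteq> boxes \<mu>"
  proof clarify
    fix x y assume xy: "(x, y) \<in> Q"
    then have "x \<in> fst ` (P \<inter> D)" "y \<in> snd ` (P \<inter> D)" unfolding Q(4,5)[symmetric] by force+
    then have pos: "1 \<le> x" "1 \<le> y" using full(1) by (auto simp: boxes_def)
    have "(x, y) \<in> dominated \<mu> S P \<or> (y, x) \<in> dominated \<mu> S P"
      using xy Q(1) by (auto simp: D_def sym_dominated_def)
    then have "(x, y) \<in> boxes \<mu> \<or> (y, x) \<in> boxes \<mu>"
      using boxes_mono[OF assms(1)] pos by (auto elim!: dominated_bound)
    then show "(x, y) \<in> boxes \<mu>" using sc unfolding self_conjugate_def by blast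
  qed
  moreover have "fst ` P' = fst ` P" "snd ` P' = snd ` P"
    unfolding P'_def image_Un Q(4,5) by blast+
  ultimately have "full_placement \<mu> P'"
    using full Q(2-5) by (auto simp: full_placement_iff P'_def intro!: inj_on_exchange)
  moreover have "P'\<inverse> = (P\<inverse> - D\<inverse>) \<union> Q\<inverse>" unfolding P'_def by blast
  then have "P'\<inverse> = P'" by (simp add: symP symQ D(2) P'_def)
  then have "symmetric_dots P'" unfolding symmetric_dots_def by blast
  moreover have "pair_free up' D P'" using pair_free_Int[OF D(1), of up' P'] int Q(6) by simp
  ultimately have "P' \<in> sym_free \<mu> S up'" by (simp add: sym_free_def D')
  moreover have "same_outside D P P'" using diff int Q(4,5) by (simp add: same_outside_def)
  ultimately show thesis using that[of P'] D' by (simp add: D_def)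
qed

text \<open>Outside \<open>D\<close> both placements agree with \<open>R\<close>; inside, both are
  pair-free on the rows and columns that \<open>R\<close> uses there, so uniqueness applies.\<close>

lemma sym_free_exchange_inj:
  assumes "P \<in> sym_free \<mu> S up" "Q \<in> sym_free \<mu> S up"
    and D: "D = sym_dominated \<mu> S P" "D = sym_dominated \<mu> S Q"
    and R: "same_outside D P R" "same_outside D Q R"
  shows "P = Q"
proof -
  have "down_set D" by (simp add: D(1) down_set_sym_dominated)
  moreover have "inj_on fst P" "inj_on snd P" "pair_free up D P" "P \<subseteq> boxes \<mu>"
    using assms(1) by (simp_all add: sym_free_def full_placement_iff D(1))
  moreover have "inj_on fst Q" "inj_on snd Q" "pair_free up D Q"
    using assms(2) by (simp_all add: sym_free_def full_placement_iff D(2))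
  moreover have "finite P" using calculation(5) finite_boxes finite_subset by blast
  ultimately have "P \<inter> D = Q \<inter> D"
    using R by (intro pair_free_unique[of D _ up])
      (auto simp: pair_free_Int same_outside_def intro: inj_on_subset)
  moreover have "P - D = Q - D" using R by (simp add: same_outside_def)
  ultimately show ?thesis by blast
qed

section \<open>Comparing the numbers of placements for the two prefixes\<close>

lemma finite_sym_free: "finite (sym_free \<mu> S up)"
  unfolding sym_free_def by (rule finite_full_placements)

lemma card_sym_free_le:
  assumes "shape \<mu>" "self_conjugate \<mu>"
  shows "card (sym_free \<mu> S up) \<le> card (sym_free \<mu> S up')"
proof -
  let ?D = "sym_dominated \<mu> S"
  have "\<forall>P \<in> sym_free \<mu> S up. \<exists>P'. P' \<in> sym_free \<mu> S up' \<and> ?D P' = ?D P \<and> same_outside (?D P) P P'"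
    using sym_free_exchange[OF assms] by metis
  then obtain F where F: "\<And>P. P \<in> sym_free \<mu> S up \<Longrightarrow> F P \<in> sym_free \<mu> S up'"
      "\<And>P. P \<in> sym_free \<mu> S up \<Longrightarrow> ?D (F P) = ?D P"
      "\<And>P. P \<in> sym_free \<mu> S up \<Longrightarrow> same_outside (?D P) P (F P)"
    by metis
  have "inj_on F (sym_free \<mu> S up)"
  proof (rule inj_onI)
    fix P Q assume h: "P \<in> sym_free \<mu> S up" "Q \<in> sym_free \<mu> S up" "F P = F Q"
    \<comment> \<open>The exchange preserves the region, so equal images come from placements with
      the same region, as \<open>sym_free_exchange_inj\<close> requires.\<close>
    have "?D P = ?D Q" using F(2)[OF h(1)] F(2)[OF h(2)] h(3) by simp
    then show "P = Q"
      using sym_free_exchange_inj[OF h(1,2) refl] F(3)[OF h(1)] F(3)[OF h(2)] h(3) by simp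
  qed
  then show ?thesis using F(1) finite_sym_free by (intro card_inj_on_le) auto
qed

lemma sym_count_eq_card_sym_free:
  assumes "shape \<mu>" "\<forall>\<tau> \<in> S. \<forall>t \<in> set \<tau>. 2 < t"
  shows "sym_count \<mu> ((@) (prefix12 up) ` S) = card (sym_free \<mu> S up)"
proof -
  have "(\<forall>\<sigma> \<in> (@) (prefix12 up) ` S. \<not> contains_pattern \<mu> P \<sigma>) \<longleftrightarrow> pair_free up (sym_dominated \<mu> S P) P"
    if "full_placement \<mu> P" "symmetric_dots P" for P
    using contains_pattern_iff[OF assms(1) _ assms(2), of P up] pair_free_sym_dominated[OF that(2)]
      that(1) by (simp add: full_placement_iff)
  then show ?thesis unfolding sym_count_def sym_free_def by (metis (no_types, lifting))
qed

lemma begins_with_12_tail: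
  assumes "begins_with_12 \<sigma>"
  shows "\<sigma> = prefix12 True @ drop 2 \<sigma>" "\<forall>t \<in> set (drop 2 \<sigma>). 2 < t"
proof -
  obtain \<tau> where \<sigma>: "\<sigma> = [1, 2] @ \<tau>" and p: "is_pattern \<sigma>"
    using assms unfolding begins_with_12_def by blast
  show "\<sigma> = prefix12 True @ drop 2 \<sigma>" by (simp add: \<sigma> prefix12_def)
  have "2 < t" if "t \<in> set \<tau>" for t
  proof -
    have "t \<in> set \<sigma>" using that \<sigma> by simp
    then have "1 \<le> t" using p by (simp add: is_pattern_def)
    moreover have "t \<noteq> 1" "t \<noteq> 2" using p that by (auto simp: \<sigma> is_pattern_def)
    ultimately show ?thesis by simp
  qed
  then show "\<forall>t \<in> set (drop 2 \<sigma>). 2 < t" by (simp add: \<sigma>)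
qed

theorem theorem4p2:
  fixes \<mu> :: "nat list" and T12 T21 :: "nat list set"
  assumes "\<forall>\<sigma> \<in> T12. begins_with_12 \<sigma>"
    and "T21 = replace_12_by_21 ` T12"
    and "shape \<mu>"
    and "self_conjugate \<mu>"
  shows "sym_count \<mu> T12 = sym_count \<mu> T21"
proof -
  define S where "S = drop 2 ` T12"
  have S: "\<forall>\<tau> \<in> S. \<forall>t \<in> set \<tau>. 2 < t" using assms(1) begins_with_12_tail(2) by (auto simp: S_def)
  have "T12 = (@) (prefix12 True) ` S"
    using assms(1) begins_with_12_tail(1) by (force simp: S_def image_image)
  moreover have "T21 = (@) (prefix12 False) ` S"
    by (auto simp: S_def image_image assms(2) replace_12_by_21_def prefix12_def)
  \<comment> \<open>The inequality holds for any two flags, so interchanging them gives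
    equality.\<close>
  moreover have "card (sym_free \<mu> S True) = card (sym_free \<mu> S False)"
    using card_sym_free_le[OF assms(3,4)] by (intro antisym)
  ultimately show ?thesis using sym_count_eq_card_sym_free[OF assms(3) S] by metis
qed

end
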